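(* Let $X$ be an arbitrary bounded metric space, let $\lambda>0$ be a real number, and let $\lambda\Delta$ be a simplex all of whose non-zero distances equal $\lambda$, of cardinality $m=\#\lambda\Delta\le\#X$. Suppose that $2d_m(X)\le\operatorname{diam}X-\alpha_m^-(X)\le 2d_m^+(X)$. Then: (1) if $\lambda\le\frac12\bigl(\alpha_m^-(X)+\operatorname{diam}X\bigr)$, then $$2d_{GH}(\lambda\Delta,X)=\operatorname{diam}X-\lambda;$$ (2) if $\frac12\bigl(\alpha_m^-(X)+\operatorname{diam}X\bigr)\le\lambda\le\alpha_m(X)+d_m^+(X)$, then $$\max\{\operatorname{diam}X-\lambda,\ \lambda-\alpha_m(X),\ d_m(X)\}\le 2d_{GH}(\lambda\Delta,X)\le\min\{\lambda-\alpha_m^-(X),\ d_m^+(X)\};$$ (3) if $\lambda\ge\alpha_m(X)+d_m^+(X)$, then $$2d_{GH}(\lambda\Delta,X)=\lambda-\alpha_m(X).$$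
   Context: Metric spaces are assumed non-empty. $\#X$ denotes the cardinality of $X$; $|xy|$ denotes the distance between points $x,y$. A simplex is a metric space all of whose non-zero distances are equal; $\lambda\Delta$ denotes a simplex whose non-zero distances all equal $\lambda>0$ (its cardinality may be any finite or infinite non-zero cardinal). For metric spaces $X,Y$, the Gromov--Hausdorff distance $d_{GH}(X,Y)$ is the infimum of real numbers $r$ for which there exist a metric space $Z$ and subsets $X',Y'\subset Z$ isometric to $X$ and $Y$, respectively, such that $d_H(X',Y')\le r$, where $d_H$ is the Hausdorff distance in $Z$. For a cardinal number $m\le\#X$ let $\mathcal{D}_m(X)$ be the set of all partitions of $X$ into $m$ non-empty subsets. For $D=\{X_i\}_{i\in I}\in\mathcal{D}_m(X)$ put $\operatorname{diam}D=\sup_{i\in I}\operatorname{diam}X_i$ and $\alpha(D)=\inf\{|X_iX_j| : i\ne j\}$, where $|AB|=\inf\{|ab| : a\in A,\ b\in B\}$ for non-empty $A,B\subset X$; for $m=1$ the infimum over the empty set is $\alpha(D)=+\infty$, and expressions are read in the extended reals. Put $$\alpha_m^-(X)=\inf_{D\in\mathcal{D}_m(X)}\alpha(D),\qquad \alpha_m(X)=\sup_{D\in\mathcal{D}_m(X)}\alpha(D),$$ $$d_m(X)=\inf_{D\in\mathcal{D}_m(X)}\operatorname{diam}D,\qquad d_m^+(X)=\sup_{D\in\mathcal{D}_m(X)}\operatorname{diam}D.$$ *)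

theory Defs
  imports "HOL-Analysis.Analysis"
begin

unbundle cardinal_syntax

definition ediam :: "'a metric \<Rightarrow> 'a set \<Rightarrow> ereal" where
  "ediam X A = (SUP x\<in>A. SUP y\<in>A. ereal (mdist X x y))"

definition egap :: "'a metric \<Rightarrow> 'a set \<Rightarrow> 'a set \<Rightarrow> ereal" where
  "egap X A B = (INF a\<in>A. INF b\<in>B. ereal (mdist X a b))"

definition hausdorff :: "'a metric \<Rightarrow> 'a set \<Rightarrow> 'a set \<Rightarrow> ereal" where
  "hausdorff X A B = max (SUP a\<in>A. egap X {a} B) (SUP b\<in>B. egap X {b} A)"

definition isometric :: "'a metric \<Rightarrow> 'b metric \<Rightarrow> bool" where
  "isometric X Y \<longleftrightarrow> (\<exists>f. bij_betw f (mspace X) (mspace Y) \<and>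
     (\<forall>x\<in>mspace X. \<forall>y\<in>mspace X. mdist Y (f x) (f y) = mdist X x y))"

text \<open>
  HOL cannot quantify over all metric spaces \<open>Z\<close> of arbitrary type inside a definition.
  Only the part \<open>X' \<union> Y'\<close> of \<open>Z\<close> matters, and it can be copied into the sum type of the
  two underlying types, so it suffices to let \<open>Z\<close> range over metric spaces whose carrier is a
  subset of that type; \<open>ghdist_le\<close> below shows that nothing is lost.
\<close>

definition ghdist :: "'a metric \<Rightarrow> 'b metric \<Rightarrow> ereal" where
  "ghdist X Y = Inf {ereal r | r. \<exists>(Z :: ('a + 'b) metric) X' Y'.
     X' \<subseteq> mspace Z \<and> Y' \<subseteq> mspace Z \<and>
     isometric X (submetric Z X') \<and> isometric Y (submetric Z Y') \<and>
     hausdorff Z X' Y' \<le> ereal r}"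

lemma ghdist_le:
  fixes X :: "'a metric" and Y :: "'b metric" and Z :: "'c metric"
  assumes X': "X' \<subseteq> mspace Z" and Y': "Y' \<subseteq> mspace Z"
    and isoX: "isometric X (submetric Z X')" and isoY: "isometric Y (submetric Z Y')"
    and r: "hausdorff Z X' Y' \<le> ereal r"
  shows "ghdist X Y \<le> ereal r"
proof -
  have msX: "mspace (submetric Z X') = X'" and msY: "mspace (submetric Z Y') = Y'"
    using X' Y' by auto
  obtain f where f: "bij_betw f (mspace X) X'"
    and fd: "\<And>x y. x \<in> mspace X \<Longrightarrow> y \<in> mspace X \<Longrightarrow> mdist Z (f x) (f y) = mdist X x y"
    using isoX unfolding isometric_def msX by auto
  obtain g where g: "bij_betw g (mspace Y) Y'"
    and gd: "\<And>x y. x \<in> mspace Y \<Longrightarrow> y \<in> mspace Y \<Longrightarrow> mdist Z (g x) (g y) = mdist Y x y"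
    using isoY unfolding isometric_def msY by auto
  define h :: "'c \<Rightarrow> 'a + 'b" where
    "h z = (if z \<in> X' then Inl (inv_into (mspace X) f z) else Inr (inv_into (mspace Y) g z))" for z
  define U where "U = X' \<union> Y'"
  have inj: "inj_on h U"
    using f g unfolding U_def h_def bij_betw_def
    by (intro inj_onI) (auto split: if_splits dest: inv_into_injective)
  define k where "k = inv_into U h"
  have kh: "k (h z) = z" if "z \<in> U" for z
    using that inj by (simp add: k_def)
  have UZ: "U \<subseteq> mspace Z" using X' Y' by (simp add: U_def)
  have MZ: "Metric_space (mspace Z) (mdist Z)" by simp
  have ms: "Metric_space (h ` U) (\<lambda>u v. mdist Z (k u) (k v))"
  proof
    fix u v w
    show "0 \<le> mdist Z (k u) (k v)" by (rule Metric_space.nonneg[OF MZ])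
    show "mdist Z (k u) (k v) = mdist Z (k v) (k u)" by (rule Metric_space.commute[OF MZ])
    assume u: "u \<in> h ` U" and v: "v \<in> h ` U"
    then have m: "k u \<in> mspace Z" "k v \<in> mspace Z" using kh UZ by auto
    show "(mdist Z (k u) (k v) = 0) = (u = v)"
      using Metric_space.zero[OF MZ m] u v kh by auto
    assume "w \<in> h ` U"
    then show "mdist Z (k u) (k w) \<le> mdist Z (k u) (k v) + mdist Z (k v) (k w)"
      using Metric_space.triangle[OF MZ m] kh UZ by auto
  qed
  define W where "W = metric (h ` U, \<lambda>u v. mdist Z (k u) (k v))"
  have W1: "mspace W = h ` U" and W2: "mdist W = (\<lambda>u v. mdist Z (k u) (k v))"
    unfolding W_def using ms by (simp_all add: Metric_space.mspace_metric Metric_space.mdist_metric)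
  have sub: "h ` X' \<subseteq> mspace W" "h ` Y' \<subseteq> mspace W"
    by (auto simp: W1 U_def)
  have dW: "mdist W (h a) (h b) = mdist Z a b" if "a \<in> U" "b \<in> U" for a b
    using that by (simp add: W2 kh)
  have iX: "isometric X (submetric W (h ` X'))"
    unfolding isometric_def
  proof (intro exI[of _ "h \<circ> f"] conjI ballI)
    have "bij_betw h X' (h ` X')" using inj by (auto simp: bij_betw_def U_def inj_on_Un)
    then show "bij_betw (h \<circ> f) (mspace X) (mspace (submetric W (h ` X')))"
      using bij_betw_trans[OF f] sub by (simp add: inf.absorb1)
    show "mdist (submetric W (h ` X')) ((h \<circ> f) x) ((h \<circ> f) y) = mdist X x y"
      if "x \<in> mspace X" "y \<in> mspace X" for x y
      using that f by (simp add: dW U_def fd bij_betwE)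
  qed
  have iY: "isometric Y (submetric W (h ` Y'))"
    unfolding isometric_def
  proof (intro exI[of _ "h \<circ> g"] conjI ballI)
    have "bij_betw h Y' (h ` Y')" using inj by (auto simp: bij_betw_def U_def inj_on_Un)
    then show "bij_betw (h \<circ> g) (mspace Y) (mspace (submetric W (h ` Y')))"
      using bij_betw_trans[OF g] sub by (simp add: inf.absorb1)
    show "mdist (submetric W (h ` Y')) ((h \<circ> g) x) ((h \<circ> g) y) = mdist Y x y"
      if "x \<in> mspace Y" "y \<in> mspace Y" for x y
      using that g by (simp add: dW U_def gd bij_betwE)
  qed
  have "hausdorff W (h ` X') (h ` Y') = hausdorff Z X' Y'"
    unfolding hausdorff_def egap_def
    by (intro arg_cong2[where f = max] SUP_cong) (simp_all add: image_image dW U_def)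
  with r have "hausdorff W (h ` X') (h ` Y') \<le> ereal r" by simp
  with sub iX iY show ?thesis
    unfolding ghdist_def by (intro Inf_lower CollectI exI[of _ r] conjI refl
      exI[of _ W] exI[of _ "h ` X'"] exI[of _ "h ` Y'"])
qed

definition simplex_space :: "real \<Rightarrow> 'a metric \<Rightarrow> bool" where
  "simplex_space lam S \<longleftrightarrow> mspace S \<noteq> {} \<and>
     (\<forall>x\<in>mspace S. \<forall>y\<in>mspace S. mdist S x y \<noteq> 0 \<longrightarrow> mdist S x y = lam)"

text \<open>A cardinal number \<open>m\<close> is given as a cardinal order, as in the HOL cardinal library.\<close>

definition partitions :: "'m rel \<Rightarrow> 'a metric \<Rightarrow> 'a set set set" where
  "partitions m X = {D. partition_on (mspace X) D \<and> |D| =o m}"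

definition part_diam :: "'a metric \<Rightarrow> 'a set set \<Rightarrow> ereal" where
  "part_diam X D = (SUP A\<in>D. ediam X A)"

text \<open>For a one-block partition this is the infimum of the empty set, that is \<open>\<infinity>\<close>.\<close>

definition part_alpha :: "'a metric \<Rightarrow> 'a set set \<Rightarrow> ereal" where
  "part_alpha X D = Inf {egap X A B | A B. A \<in> D \<and> B \<in> D \<and> A \<noteq> B}"

definition alpha_minus :: "'m rel \<Rightarrow> 'a metric \<Rightarrow> ereal" where
  "alpha_minus m X = (INF D\<in>partitions m X. part_alpha X D)"

definition alpha :: "'m rel \<Rightarrow> 'a metric \<Rightarrow> ereal" where
  "alpha m X = (SUP D\<in>partitions m X. part_alpha X D)"

definition dpart :: "'m rel \<Rightarrow> 'a metric \<Rightarrow> ereal" where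
  "dpart m X = (INF D\<in>partitions m X. part_diam X D)"

definition dpart_plus :: "'m rel \<Rightarrow> 'a metric \<Rightarrow> ereal" where
  "dpart_plus m X = (SUP D\<in>partitions m X. part_diam X D)"

end

theory Submission
  imports Defs
begin

text \<open>
  Everything follows from one formula, \<open>two_ghdist_simplex_eq\<close>: if the simplex \<open>S\<close> of edge length
  \<open>\<lambda>\<close> has at most as many points as \<open>X\<close>, then \<open>2 * ghdist S X\<close> is the infimum, over the partitions
  \<open>D\<close> of \<open>X\<close> into \<open>|S|\<close> blocks, of
  \<open>max (diam D) (max (\<lambda> - \<alpha>(D)) (diam X - \<lambda>))\<close>.

  Such a partition is the same thing as a surjection of \<open>X\<close> onto \<open>S\<close>, by way of its fibres, and the
  displayed maximum is the distortion of that surjection: points of one fibre go to distance \<open>0\<close>,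
  which contributes \<open>diam D\<close>, and points of different fibres go to distance \<open>\<lambda>\<close>, which contributes
  \<open>\<lambda> - \<alpha>(D)\<close> and \<open>diam X - \<lambda>\<close>. So the formula says that surjections compute the distance.
  That half the distortion of a surjection bounds the distance is a gluing
  construction (\<open>ghdist_le_half_distortion\<close>). Conversely, two copies at Hausdorff distance less
  than \<open>s\<close> in a common space give a relation between \<open>S\<close> and \<open>X\<close> that distorts distances by at most
  \<open>2 * s\<close>, and \<open>simplex_correspondence_surjection\<close> replaces the relation by a surjection.
  If \<open>2 * s < \<lambda>\<close> the relation already is one, since a point of \<open>X\<close> related to two points of \<open>S\<close>
  would cost \<open>\<lambda>\<close>. If \<open>2 * s \<ge> \<lambda>\<close>, a map \<open>X \<rightarrow> S\<close> selected from the relation may miss points of \<open>S\<close>, but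
  its fibres can be split until there are \<open>|S|\<close> of them: separating points costs at most \<open>\<lambda>\<close>.

  Replacing \<open>diam D\<close> and \<open>\<alpha>(D)\<close> by their extreme values over all partitions sandwiches
  the infimum (\<open>INF_partition_cost_ge\<close>, \<open>INF_partition_cost_le_dpart\<close>,
  \<open>INF_partition_cost_le_dpart_plus\<close>), and the hypotheses on \<open>diam X - \<alpha>\<^sup>-\<close> decide which term of
  each maximum dominates. They also exclude one-point simplexes, for which \<open>\<alpha>\<^sup>-\<close> is infinite.
\<close>

section \<open>Partitions of prescribed cardinality as surjections\<close>

text \<open>
  Between \<open>T\<close> and the union of \<open>T\<close> with a copy of \<open>B\<close> inside \<open>A\<close> there is a set as large as \<open>B\<close>: if
  \<open>B\<close> is infinite, the union itself; if \<open>B\<close> is finite, a set obtained from \<open>T\<close> by adding points of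
  the union one at a time.
\<close>

lemma ex_intermediate_set_card:
  fixes B :: "'b set" and A :: "'a set"
  assumes "T \<subseteq> A" and "|T| \<le>o |B|" and "|B| \<le>o |A|"
  obtains M where "T \<subseteq> M" and "M \<subseteq> A" and "|M| =o |B|"
proof -
  obtain j where j: "inj_on j B" "j ` B \<subseteq> A"
    using assms(3) card_of_ordLeq[of B A] by blast
  have "\<exists>M. T \<subseteq> M \<and> M \<subseteq> T \<union> j ` B \<and> |M| =o |B|"
  proof (cases "finite B")
    case True
    obtain i where i: "inj_on i T" "i ` T \<subseteq> B"
      using assms(2) card_of_ordLeq[of T B] by blast
    have fin: "finite (T \<union> j ` B)"
      using True assms(2) card_of_ordLeq_finite by blast
    have "card T \<le> card B"
      using i True by (rule card_inj_on_le)
    moreover have "card B \<le> card (T \<union> j ` B)"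
      using j(1) fin by (metis card_image card_mono sup_ge2)
    ultimately obtain M where M: "T \<subseteq> M" "M \<subseteq> T \<union> j ` B" "card M = card B"
      using exists_subset_between[of T "card B" "T \<union> j ` B"] fin by auto
    then have "finite M" using fin finite_subset by blast
    then obtain b where "bij_betw b M B"
      using True M(3) finite_same_card_bij by blast
    with M show ?thesis using card_of_ordIso by blast
  next
    case False
    have jB: "|j ` B| \<le>o |B|" by (rule card_of_image)
    have "|T \<union> j ` B| \<le>o |B|"
      using card_of_Un_ordLeq_infinite_Field[OF _ assms(2) jB card_of_Card_order] False
      by (simp add: Field_card_of)
    moreover have "|B| \<le>o |T \<union> j ` B|"
      using j(1) card_of_ordLeq[of B "T \<union> j ` B"] by blast
    ultimately show ?thesis
      by (intro exI[of _ "T \<union> j ` B"]) (auto simp: ordIso_iff_ordLeq)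
  qed
  then obtain M where M: "T \<subseteq> M" "M \<subseteq> T \<union> j ` B" "|M| =o |B|" by (elim exE conjE)
  have "M \<subseteq> A" using M(2) j(2) assms(1) by auto
  with M show ?thesis by (intro that)
qed

text \<open>
  The fibres of \<open>f\<close> are split by enlarging a transversal \<open>T\<close> of them to a set \<open>M\<close> with as many
  elements as \<open>B\<close>: the retraction of \<open>A\<close> onto \<open>M\<close> that sends the points outside \<open>M\<close> to the
  representatives of their fibres has exactly \<open>|B|\<close> fibres. This treats finite and infinite
  cardinals alike.
\<close>

lemma ex_surjection_refining:
  fixes f :: "'a \<Rightarrow> 'b"
  assumes fA: "f ` A \<subseteq> B" and BA: "|B| \<le>o |A|"
  obtains g where "g ` A = B" and "\<And>x y. x \<in> A \<Longrightarrow> y \<in> A \<Longrightarrow> g x = g y \<Longrightarrow> f x = f y"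
proof -
  define s where "s = inv_into A f"
  have s: "s (f x) \<in> A" "f (s (f x)) = f x" if "x \<in> A" for x
    using that by (auto simp: s_def inv_into_into f_inv_into_f)
  have "|s ` (f ` A)| \<le>o |B|"
    using card_of_image[of s "f ` A"] card_of_mono1[OF fA] ordLeq_transitive by blast
  then obtain M where M: "s ` f ` A \<subseteq> M" "M \<subseteq> A" "|M| =o |B|"
    using ex_intermediate_set_card[of "s ` f ` A" A B] s BA by blast
  obtain b where b: "bij_betw b M B" using M(3) card_of_ordIso by blast
  define r where "r x = (if x \<in> M then x else s (f x))" for x
  have rM: "r ` A = M"
    using M by (auto simp: r_def image_iff)
  have fr: "f (r x) = f x" if "x \<in> A" for x using s that by (simp add: r_def)
  show ?thesis
  proof (rule that[of "b \<circ> r"])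
    show "(b \<circ> r) ` A = B" using rM b by (metis bij_betw_imp_surj_on image_comp)
    show "f x = f y" if "x \<in> A" "y \<in> A" "(b \<circ> r) x = (b \<circ> r) y" for x y
    proof -
      have "r x = r y"
        using b that rM by (auto simp: bij_betw_def inj_on_def)
      then show ?thesis using fr that by metis
    qed
  qed
qed

definition fibres :: "('a \<Rightarrow> 'b) \<Rightarrow> 'a set \<Rightarrow> 'a set set" where
  "fibres g A = (\<lambda>i. {x\<in>A. g x = i}) ` (g ` A)"

lemma fibres_in_partitions:
  assumes "g ` mspace X = B"
  shows "fibres g (mspace X) \<in> partitions |B| X"
proof -
  have "inj_on (\<lambda>i. {x\<in>mspace X. g x = i}) B"
    using assms by (fastforce simp: inj_on_def)
  then have "|B| =o |fibres g (mspace X)|"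
    unfolding fibres_def assms by (metis bij_betw_imageI card_of_ordIso)
  moreover have "partition_on (mspace X) (fibres g (mspace X))"
    by (rule partition_onI) (auto simp: fibres_def disjnt_def)
  ultimately show ?thesis
    by (simp add: partitions_def ordIso_symmetric)
qed

text \<open>
  Conversely, a bijection from the blocks onto \<open>B\<close>, composed with the map sending each point to its
  block, is a surjection whose fibres are the blocks.
\<close>

lemma partition_eq_fibres:
  assumes "D \<in> partitions |B| X"
  obtains g where "g ` mspace X = B" and "D = fibres g (mspace X)"
proof -
  have P: "partition_on (mspace X) D" and "|D| =o |B|"
    using assms by (auto simp: partitions_def)
  then obtain h where h: "bij_betw h D B" using card_of_ordIso by blast
  have U: "\<Union>D = mspace X" and ne: "{} \<notin> D"
    using P by (auto simp: partition_on_def)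
  have uniq: "A = A'" if "x \<in> A" "x \<in> A'" "A \<in> D" "A' \<in> D" for x A A'
    using P that by (auto simp: partition_on_def disjoint_def)
  define k where "k x = (THE A. A \<in> D \<and> x \<in> A)" for x
  have k: "k x = A" if "x \<in> A" "A \<in> D" for x A
    unfolding k_def by (rule the_equality) (use that uniq in auto)
  have kX: "k x \<in> D" "x \<in> k x" if x: "x \<in> mspace X" for x
  proof -
    obtain A where A: "A \<in> D" "x \<in> A" using x U by blast
    show "k x \<in> D" "x \<in> k x" unfolding k[OF A(2,1)] by (fact A)+
  qed
  have kD: "k ` mspace X = D"
  proof
    show "D \<subseteq> k ` mspace X"
    proof
      fix A assume A: "A \<in> D"
      with ne obtain x where "x \<in> A" by (metis ex_in_conv)
      with A U k show "A \<in> k ` mspace X" by blast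
    qed
  qed (use kX in blast)
  have fib: "{x\<in>mspace X. h (k x) = h A} = A" if A: "A \<in> D" for A
  proof -
    have "h (k x) = h A \<longleftrightarrow> k x = A" if "x \<in> mspace X" for x
      using h A kX(1)[OF that] by (auto simp: bij_betw_def inj_on_def)
    then show ?thesis using A U k kX by blast
  qed
  show ?thesis
  proof (rule that[of "h \<circ> k"])
    have hk: "(h \<circ> k) ` mspace X = h ` D"
      using kD by (metis image_comp)
    then show "(h \<circ> k) ` mspace X = B"
      using h by (simp add: bij_betw_def)
    show "D = fibres (h \<circ> k) (mspace X)"
      unfolding fibres_def hk by (simp add: image_image fib)
  qed
qed

section \<open>Gromov--Hausdorff distance and distortion\<close>

text \<open>
  The relation is closeness of the two isometric copies in the common space; closeness is
  measured by \<open>s\<close> and not by the Hausdorff distance itself, within which a point may have no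
  partner, the infimum of its distances to the other copy not being attained.
\<close>

lemma ghdist_lessD_correspondence:
  assumes "ghdist Y X < ereal s"
  obtains R where "\<And>y. y \<in> mspace Y \<Longrightarrow> \<exists>x\<in>mspace X. R y x"
    and "\<And>x. x \<in> mspace X \<Longrightarrow> \<exists>y\<in>mspace Y. R y x"
    and "\<And>x x' y y'. \<lbrakk>x \<in> mspace X; x' \<in> mspace X; y \<in> mspace Y; y' \<in> mspace Y; R y x; R y' x'\<rbrakk>
           \<Longrightarrow> \<bar>mdist X x x' - mdist Y y y'\<bar> \<le> 2 * s"
proof -
  obtain r and Z :: "('a + 'b) metric" and Y' X' where r: "r < s"
    and sub: "Y' \<subseteq> mspace Z" "X' \<subseteq> mspace Z"
    and iY: "isometric Y (submetric Z Y')" and iX: "isometric X (submetric Z X')"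
    and H: "hausdorff Z Y' X' \<le> ereal r"
    using assms unfolding ghdist_def Inf_less_iff by auto
  have ms: "mspace (submetric Z X') = X'" "mspace (submetric Z Y') = Y'" using sub by auto
  obtain f where f: "bij_betw f (mspace Y) Y'"
    and fd: "\<And>x y. x \<in> mspace Y \<Longrightarrow> y \<in> mspace Y \<Longrightarrow> mdist Z (f x) (f y) = mdist Y x y"
    using iY unfolding isometric_def ms by auto
  obtain g where g: "bij_betw g (mspace X) X'"
    and gd: "\<And>x y. x \<in> mspace X \<Longrightarrow> y \<in> mspace X \<Longrightarrow> mdist Z (g x) (g y) = mdist X x y"
    using iX unfolding isometric_def ms by auto
  have Hs: "hausdorff Z Y' X' < ereal s" using H r by (simp add: order_le_less_trans)
  have near: "\<exists>b\<in>B. mdist Z a b < s" if "a \<in> A" "(SUP a\<in>A. egap Z {a} B) < ereal s" for a A B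
  proof -
    have "egap Z {a} B < ereal s" using that by (metis SUP_lessD)
    then show ?thesis by (auto simp: egap_def INF_less_iff)
  qed
  define R where "R y x \<longleftrightarrow> mdist Z (f y) (g x) < s" for y x
  have fY: "f ` mspace Y = Y'" and gX: "g ` mspace X = X'" using f g by (auto simp: bij_betw_def)
  show ?thesis
  proof (rule that[of R])
    show "\<exists>x\<in>mspace X. R y x" if "y \<in> mspace Y" for y
      using near[of "f y" Y' X'] Hs that fY gX by (auto simp: hausdorff_def R_def)
    show "\<exists>y\<in>mspace Y. R y x" if "x \<in> mspace X" for x
    proof -
      have "\<exists>b\<in>Y'. mdist Z (g x) b < s"
        using near[of "g x" X' Y'] Hs that gX by (auto simp: hausdorff_def)
      then show ?thesis using fY by (auto simp: R_def mdist_commute)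
    qed
    fix x x' y y'
    assume A: "x \<in> mspace X" "x' \<in> mspace X" "y \<in> mspace Y" "y' \<in> mspace Y" "R y x" "R y' x'"
    have mem: "f y \<in> mspace Z" "f y' \<in> mspace Z" "g x \<in> mspace Z" "g x' \<in> mspace Z"
      using A fY gX sub by auto
    have "mdist Z (f y) (f y') \<le> mdist Z (f y) (g x) + mdist Z (g x) (g x') + mdist Z (f y') (g x')"
      using mdist_triangle[of "f y" Z "g x" "f y'"] mdist_triangle[of "g x" Z "g x'" "f y'"] mem
      by (simp add: mdist_commute[of Z "f y'"])
    moreover have "mdist Z (g x) (g x') \<le> mdist Z (f y) (g x) + mdist Z (f y) (f y') + mdist Z (f y') (g x')"
      using mdist_triangle[of "g x" Z "f y" "g x'"] mdist_triangle[of "f y" Z "f y'" "g x'"] mem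
      by (simp add: mdist_commute[of Z "g x"])
    ultimately show "\<bar>mdist X x x' - mdist Y y y'\<bar> \<le> 2 * s"
      using A by (simp add: R_def fd gd)
  qed
qed

text \<open>
  Both spaces are glued along \<open>g\<close>: on their disjoint union the distance from \<open>y\<close> to \<open>x\<close> is the infimum
  of the lengths of the routes that walk in \<open>Y\<close> from \<open>y\<close> to some \<open>g u\<close>, jump to \<open>u\<close> at the price \<open>t / 2\<close>, and
  walk on in \<open>X\<close> to \<open>x\<close>. A detour from one space through the other pays two jumps, that is \<open>t\<close>, and
  this makes up for the distortion, so the original distances survive. Positivity of \<open>t\<close> keeps
  \<open>x\<close> and \<open>g x\<close> apart.
\<close>

lemma ghdist_le_half_distortion:
  fixes X :: "'a metric" and Y :: "'b metric"
  assumes X: "mspace X \<noteq> {}" and g: "g ` mspace X = mspace Y" and t: "t > 0"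
    and dis: "\<And>x x'. x \<in> mspace X \<Longrightarrow> x' \<in> mspace X \<Longrightarrow>
       \<bar>mdist X x x' - mdist Y (g x) (g x')\<bar> \<le> t"
  shows "ghdist Y X \<le> ereal (t / 2)"
proof -
  \<comment> \<open>\<open>c y x\<close> is the infimum of the lengths of the routes, without the price of the jump.\<close>
  define c where "c y x = (INF u\<in>mspace X. mdist Y y (g u) + mdist X u x)" for y x
  have bdd: "bdd_below ((\<lambda>u. mdist Y y (g u) + mdist X u x) ` mspace X)" for y x
    by (rule bdd_belowI[of _ 0]) auto
  have c_le: "c y x \<le> mdist Y y (g u) + mdist X u x" if "u \<in> mspace X" for y x u
    unfolding c_def by (rule cINF_lower[OF bdd that])
  have le_c: "a \<le> c y x" if "\<And>u. u \<in> mspace X \<Longrightarrow> a \<le> mdist Y y (g u) + mdist X u x" for a y x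
    unfolding c_def by (rule cINF_greatest[OF X]) (rule that)
  have c0: "0 \<le> c y x" for y x by (rule le_c) simp
  have gY: "g u \<in> mspace Y" if "u \<in> mspace X" for u using g that by blast
  have lipY: "c y x \<le> mdist Y y y' + c y' x" if "y \<in> mspace Y" "y' \<in> mspace Y" for y y' x
  proof -
    have "c y x - mdist Y y y' \<le> c y' x"
    proof (rule le_c)
      fix u assume u: "u \<in> mspace X"
      show "c y x - mdist Y y y' \<le> mdist Y y' (g u) + mdist X u x"
        using c_le[OF u, of y x] mdist_triangle[OF that gY[OF u]] by linarith
    qed
    then show ?thesis by simp
  qed
  have lipX: "c y x \<le> c y x' + mdist X x' x" if "x \<in> mspace X" "x' \<in> mspace X" for y x x'
  proof -
    have "c y x - mdist X x' x \<le> c y x'"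
    proof (rule le_c)
      fix u assume u: "u \<in> mspace X"
      show "c y x - mdist X x' x \<le> mdist Y y (g u) + mdist X u x'"
        using c_le[OF u, of y x] mdist_triangle[OF u that(2,1)] by linarith
    qed
    then show ?thesis by simp
  qed
  have sum_c: "a \<le> c y x + c y' x' + t"
    if "\<And>u v. u \<in> mspace X \<Longrightarrow> v \<in> mspace X \<Longrightarrow>
          a \<le> mdist Y y (g u) + mdist X u x + (mdist Y y' (g v) + mdist X v x') + t" for a y y' x x'
  proof -
    have "a - t - c y' x' \<le> c y x"
    proof (rule le_c)
      fix u assume u: "u \<in> mspace X"
      have "a - t - (mdist Y y (g u) + mdist X u x) \<le> c y' x'"
        by (rule le_c) (use that[OF u] in \<open>simp add: algebra_simps\<close>)
      then show "a - t - c y' x' \<le> mdist Y y (g u) + mdist X u x" by simp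
    qed
    then show ?thesis by simp
  qed
  have triY: "mdist Y y y' \<le> c y x + c y' x + t"
    if m: "y \<in> mspace Y" "y' \<in> mspace Y" "x \<in> mspace X" for y y' x
  proof (rule sum_c)
    fix u v assume u: "u \<in> mspace X" and v: "v \<in> mspace X"
    show "mdist Y y y' \<le> mdist Y y (g u) + mdist X u x + (mdist Y y' (g v) + mdist X v x) + t"
      using mdist_triangle[OF m(1) gY[OF u] m(2)] mdist_triangle[OF gY[OF u] gY[OF v] m(2)]
        mdist_triangle[OF u m(3) v] dis[OF u v]
      by (simp add: mdist_commute[of X x v] mdist_commute[of Y "g v" y'])
  qed
  have triX: "mdist X x x' \<le> c y x + c y x' + t"
    if m: "x \<in> mspace X" "x' \<in> mspace X" "y \<in> mspace Y" for x x' y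
  proof (rule sum_c)
    fix u v assume u: "u \<in> mspace X" and v: "v \<in> mspace X"
    show "mdist X x x' \<le> mdist Y y (g u) + mdist X u x + (mdist Y y (g v) + mdist X v x') + t"
      using mdist_triangle[OF m(1) u m(2)] mdist_triangle[OF u v m(2)]
        mdist_triangle[OF gY[OF u] m(3) gY[OF v]] dis[OF u v]
      by (simp add: mdist_commute[of X x u] mdist_commute[of Y "g u" y])
  qed
  define U where "U = Inl ` mspace Y \<union> Inr ` mspace X"
  define d where "d p q = (case (p, q) of
      (Inl y, Inl y') \<Rightarrow> mdist Y y y'
    | (Inr x, Inr x') \<Rightarrow> mdist X x x'
    | (Inl y, Inr x) \<Rightarrow> c y x + t / 2
    | (Inr x, Inl y) \<Rightarrow> c y x + t / 2)" for p q :: "'b + 'a"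
  have d_simps [simp]: "d (Inl y) (Inl y') = mdist Y y y'" "d (Inr x) (Inr x') = mdist X x x'"
    "d (Inl y) (Inr x) = c y x + t / 2" "d (Inr x) (Inl y) = c y x + t / 2" for x x' y y'
    by (simp_all add: d_def)
  have pos: "c y x + t / 2 \<noteq> 0" for y x using c0[of y x] t by linarith
  have tri: "d (Inl y) (Inr x) \<le> d (Inl y) (Inl y') + d (Inl y') (Inr x)"
      "d (Inr x) (Inl y) \<le> d (Inr x) (Inl y') + d (Inl y') (Inl y)"
      "d (Inl y) (Inl y') \<le> d (Inl y) (Inr x) + d (Inr x) (Inl y')"
      "d (Inl y) (Inr x) \<le> d (Inl y) (Inr x') + d (Inr x') (Inr x)"
      "d (Inr x) (Inl y) \<le> d (Inr x) (Inr x') + d (Inr x') (Inl y)"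
      "d (Inr x) (Inr x') \<le> d (Inr x) (Inl y) + d (Inl y) (Inr x')"
    if "x \<in> mspace X" "x' \<in> mspace X" "y \<in> mspace Y" "y' \<in> mspace Y" for x x' y y'
    using lipY[of y y' x] lipX[of x x' y] triY[of y y' x] triX[of x x' y] that
      mdist_commute[of X x' x] mdist_commute[of Y y' y]
    by simp_all
  have tri': "d (Inl y) (Inl y'') \<le> d (Inl y) (Inl y') + d (Inl y') (Inl y'')"
    if "y \<in> mspace Y" "y' \<in> mspace Y" "y'' \<in> mspace Y" for y y' y''
    using mdist_triangle that by simp
  have tri'': "d (Inr x) (Inr x'') \<le> d (Inr x) (Inr x') + d (Inr x') (Inr x'')"
    if "x \<in> mspace X" "x' \<in> mspace X" "x'' \<in> mspace X" for x x' x''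
    using mdist_triangle that by simp
  have MS: "Metric_space U d"
  proof
    fix p q w
    show "0 \<le> d p q" using t c0 by (cases p; cases q) (auto simp: add_nonneg_nonneg)
    show "d p q = d q p" by (cases p; cases q) (auto simp: mdist_commute)
    assume p: "p \<in> U" and q: "q \<in> U"
    then show "(d p q = 0) = (p = q)" using pos by (auto simp: U_def)
    assume w: "w \<in> U"
    show "d p w \<le> d p q + d q w"
      using p q w unfolding U_def
      by (auto simp del: d_simps intro: tri tri' tri'')
  qed
  define Z where "Z = metric (U, d)"
  have Z: "mspace Z = U" "mdist Z = d"
    using MS by (simp_all add: Z_def Metric_space.mspace_metric Metric_space.mdist_metric)
  have gap: "c (g x) x = 0" if "x \<in> mspace X" for x
  proof -
    have "mdist Y (g x) (g x) = 0" "mdist X x x = 0" using that gY by simp_all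
    then show ?thesis using c_le[OF that, of "g x" x] c0[of "g x" x] by linarith
  qed
  show ?thesis
  proof (rule ghdist_le[of "Inl ` mspace Y" Z "Inr ` mspace X"])
    show sub: "Inl ` mspace Y \<subseteq> mspace Z" "Inr ` mspace X \<subseteq> mspace Z" by (auto simp: Z U_def)
    show "isometric Y (submetric Z (Inl ` mspace Y))"
      unfolding isometric_def using sub
      by (intro exI[of _ Inl]) (auto simp: Z bij_betw_def inf.absorb1)
    show "isometric X (submetric Z (Inr ` mspace X))"
      unfolding isometric_def using sub
      by (intro exI[of _ Inr]) (auto simp: Z bij_betw_def inf.absorb1)
    have "egap Z {Inl y} (Inr ` mspace X) \<le> ereal (t / 2)" if y: "y \<in> mspace Y" for y
    proof -
      obtain x where x: "x \<in> mspace X" "y = g x" using g y by blast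
      then show ?thesis using gap[of x] by (auto simp: egap_def Z image_image intro!: INF_lower2[of x])
    qed
    moreover have "egap Z {Inr x} (Inl ` mspace Y) \<le> ereal (t / 2)" if x: "x \<in> mspace X" for x
      using gap[OF x] gY[OF x] by (auto simp: egap_def Z image_image intro!: INF_lower2[of "g x"])
    ultimately show "hausdorff Z (Inl ` mspace Y) (Inr ` mspace X) \<le> ereal (t / 2)"
      by (auto simp: hausdorff_def SUP_le_iff)
  qed
qed

section \<open>Distance to a simplex\<close>

lemma simplex_mdist:
  assumes "simplex_space lam S" "i \<in> mspace S" "j \<in> mspace S"
  shows "mdist S i j = (if i = j then 0 else lam)"
  using assms unfolding simplex_space_def by (metis mdist_zero)

text \<open>
  The simplex structure enters through the threshold \<open>lam\<close>: below it the relation is a surjection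
  by itself, above it points of \<open>X\<close> may be separated at will.
\<close>

lemma simplex_correspondence_surjection:
  assumes S: "simplex_space lam S" and card: "|mspace S| \<le>o |mspace X|"
    and R1: "\<And>i. i \<in> mspace S \<Longrightarrow> \<exists>x\<in>mspace X. R i x"
    and R2: "\<And>x. x \<in> mspace X \<Longrightarrow> \<exists>i\<in>mspace S. R i x"
    and dis: "\<And>x x' i i'. \<lbrakk>x \<in> mspace X; x' \<in> mspace X; i \<in> mspace S; i' \<in> mspace S; R i x; R i' x'\<rbrakk>
           \<Longrightarrow> \<bar>mdist X x x' - mdist S i i'\<bar> \<le> t"
  shows "\<exists>g. g ` mspace X = mspace S \<and>
    (\<forall>x\<in>mspace X. \<forall>x'\<in>mspace X. \<bar>mdist X x x' - mdist S (g x) (g x')\<bar> \<le> t)"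
proof -
  obtain f where f: "\<And>x. x \<in> mspace X \<Longrightarrow> f x \<in> mspace S \<and> R (f x) x"
    using R2 by metis
  have fdis: "\<bar>mdist X x x' - mdist S (f x) (f x')\<bar> \<le> t" if "x \<in> mspace X" "x' \<in> mspace X" for x x'
    using dis f that by blast
  show ?thesis
  proof (cases "t < lam")
    case True
    \<comment> \<open>Two different partners of \<open>x\<close> have distance \<open>lam > t\<close>, while \<open>x\<close> has distance \<open>0\<close> to itself.\<close>
    have uniq: "i = f x" if "x \<in> mspace X" "i \<in> mspace S" "R i x" for i x
    proof (rule ccontr)
      assume "i \<noteq> f x"
      then have "mdist S i (f x) = lam" using simplex_mdist[OF S] f that by auto
      moreover have "\<bar>mdist X x x - mdist S i (f x)\<bar> \<le> t" using dis f that by blast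
      moreover have "mdist X x x = 0" using that by simp
      ultimately show False using True by simp
    qed
    have "f ` mspace X = mspace S" using f uniq R1 by blast
    then show ?thesis using fdis by blast
  next
    case False
    obtain g where g: "g ` mspace X = mspace S"
      and gf: "\<And>x y. x \<in> mspace X \<Longrightarrow> y \<in> mspace X \<Longrightarrow> g x = g y \<Longrightarrow> f x = f y"
      using ex_surjection_refining[OF _ card, of f] f by blast
    show ?thesis
    proof (intro exI[of _ g] conjI ballI g)
      fix x x' assume x: "x \<in> mspace X" "x' \<in> mspace X"
      have "g x \<in> mspace S" "g x' \<in> mspace S" using g x by auto
      then have "mdist S (g x) (g x') = (if g x = g x' then 0 else lam)"
        by (rule simplex_mdist[OF S])
      moreover have "mdist S (f x) (f x') = (if f x = f x' then 0 else lam)"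
        using simplex_mdist[OF S] f x by blast
      \<comment> \<open>Only pairs with \<open>f x = f x'\<close> and \<open>g x \<noteq> g x'\<close> are new. For them \<open>mdist X x x' \<le> t\<close>, and
        \<open>lam\<close> lies in \<open>[0, t]\<close> as well.\<close>
      ultimately show "\<bar>mdist X x x' - mdist S (g x) (g x')\<bar> \<le> t"
        using fdis[OF x] gf[OF x] False mdist_nonneg[of X x x'] mdist_nonneg[of S "g x" "g x'"]
        unfolding abs_le_iff
        by (simp del: mdist_nonneg split: if_splits)
    qed
  qed
qed

text \<open>
  This is the distortion of any bijective labelling of the blocks of \<open>D\<close> by the vertices of a simplex
  with edge length \<open>lam\<close>; see \<open>distortion_le_iff_partition_cost_le\<close>.
\<close>

definition partition_cost :: "real \<Rightarrow> 'a metric \<Rightarrow> 'a set set \<Rightarrow> ereal" where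
  "partition_cost lam X D = max (part_diam X D)
     (max (ereal lam - part_alpha X D) (ediam X (mspace X) - ereal lam))"

lemma part_diam_fibres_le_iff:
  "part_diam X (fibres g (mspace X)) \<le> ereal t \<longleftrightarrow>
   (\<forall>x\<in>mspace X. \<forall>y\<in>mspace X. g x = g y \<longrightarrow> mdist X x y \<le> t)"
  unfolding part_diam_def ediam_def fibres_def by (auto simp: SUP_le_iff)

lemma le_part_alpha_fibres_iff:
  "ereal t \<le> part_alpha X (fibres g (mspace X)) \<longleftrightarrow>
   (\<forall>x\<in>mspace X. \<forall>y\<in>mspace X. g x \<noteq> g y \<longrightarrow> t \<le> mdist X x y)"
  (is "?L \<longleftrightarrow> ?R")
proof -
  have "?L \<longleftrightarrow> (\<forall>A\<in>fibres g (mspace X). \<forall>B\<in>fibres g (mspace X). A \<noteq> B \<longrightarrow>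
      (\<forall>a\<in>A. \<forall>b\<in>B. t \<le> mdist X a b))"
  proof -
    have "ereal t \<le> egap X A B \<longleftrightarrow> (\<forall>a\<in>A. \<forall>b\<in>B. t \<le> mdist X a b)" for A B
      by (simp add: egap_def le_INF_iff)
    moreover have "?L \<longleftrightarrow> (\<forall>A\<in>fibres g (mspace X). \<forall>B\<in>fibres g (mspace X). A \<noteq> B \<longrightarrow>
        ereal t \<le> egap X A B)"
      unfolding part_alpha_def le_Inf_iff by blast
    ultimately show ?thesis by simp
  qed
  also have "\<dots> \<longleftrightarrow> ?R"
  proof
    assume L: "\<forall>A\<in>fibres g (mspace X). \<forall>B\<in>fibres g (mspace X). A \<noteq> B \<longrightarrow>
      (\<forall>a\<in>A. \<forall>b\<in>B. t \<le> mdist X a b)"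
    show ?R
    proof (intro ballI impI)
      fix x y assume xy: "x \<in> mspace X" "y \<in> mspace X" "g x \<noteq> g y"
      let ?F = "\<lambda>i. {z\<in>mspace X. g z = i}"
      have F: "?F (g x) \<in> fibres g (mspace X)" "?F (g y) \<in> fibres g (mspace X)"
        using xy by (auto simp: fibres_def)
      have "?F (g x) \<noteq> ?F (g y)" using xy by auto
      from L[rule_format, OF F this] show "t \<le> mdist X x y" using xy by simp
    qed
  next
    assume R: ?R
    show "\<forall>A\<in>fibres g (mspace X). \<forall>B\<in>fibres g (mspace X). A \<noteq> B \<longrightarrow>
      (\<forall>a\<in>A. \<forall>b\<in>B. t \<le> mdist X a b)"
    proof (intro ballI impI)
      fix A B a b
      assume A: "A \<in> fibres g (mspace X)" "B \<in> fibres g (mspace X)" "A \<noteq> B" "a \<in> A" "b \<in> B"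
      then have "a \<in> mspace X" "b \<in> mspace X" "g a \<noteq> g b" by (auto simp: fibres_def)
      then show "t \<le> mdist X a b" using R by blast
    qed
  qed
  finally show ?thesis .
qed

text \<open>
  The upper estimate \<open>mdist X x y - lam \<le> t\<close> comes from pairs in different fibres, yet it may be imposed on
  all pairs: within a fibre it is weaker than \<open>mdist X x y \<le> t\<close>. Hence \<open>ediam X (mspace X) - lam\<close>
  appears in place of a diameter taken across blocks.
\<close>

lemma distortion_le_iff_partition_cost_le:
  assumes S: "simplex_space lam S" and lam: "lam > 0" and g: "g ` mspace X = mspace S"
  shows "(\<forall>x\<in>mspace X. \<forall>y\<in>mspace X. \<bar>mdist X x y - mdist S (g x) (g y)\<bar> \<le> t) \<longleftrightarrow>
         partition_cost lam X (fibres g (mspace X)) \<le> ereal t"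
proof -
  have "ereal lam - a \<le> ereal t \<longleftrightarrow> ereal (lam - t) \<le> a" for a
    by (cases a) auto
  moreover have "a - ereal lam \<le> ereal t \<longleftrightarrow> a \<le> ereal (lam + t)" for a
    by (cases a) auto
  moreover have "ediam X (mspace X) \<le> ereal (lam + t) \<longleftrightarrow>
      (\<forall>x\<in>mspace X. \<forall>y\<in>mspace X. mdist X x y \<le> lam + t)"
    by (simp add: ediam_def SUP_le_iff)
  ultimately have cost_iff: "partition_cost lam X (fibres g (mspace X)) \<le> ereal t \<longleftrightarrow>
      (\<forall>x\<in>mspace X. \<forall>y\<in>mspace X. (g x = g y \<longrightarrow> mdist X x y \<le> t) \<and>
         (g x \<noteq> g y \<longrightarrow> lam - t \<le> mdist X x y) \<and> mdist X x y \<le> lam + t)"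
    unfolding partition_cost_def by (auto simp: part_diam_fibres_le_iff le_part_alpha_fibres_iff)
  have pt: "\<bar>mdist X x y - mdist S (g x) (g y)\<bar> \<le> t \<longleftrightarrow> (g x = g y \<longrightarrow> mdist X x y \<le> t) \<and>
         (g x \<noteq> g y \<longrightarrow> lam - t \<le> mdist X x y) \<and> mdist X x y \<le> lam + t"
    if "x \<in> mspace X" "y \<in> mspace X" for x y
  proof -
    have "g x \<in> mspace S" "g y \<in> mspace S" using g that by auto
    then have "mdist S (g x) (g y) = (if g x = g y then 0 else lam)"
      by (rule simplex_mdist[OF S])
    then show ?thesis using lam mdist_nonneg[of X x y] by (auto simp: abs_le_iff simp del: mdist_nonneg)
  qed
  show ?thesis unfolding cost_iff using pt by simp
qed

text \<open>
  Both inequalities are tested on real upper bounds \<open>t\<close> and enlarged by \<open>e > 0\<close>: the gluing metric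
  requires a positive jump, and the correspondence a strict inequality.
\<close>

theorem two_ghdist_simplex_eq:
  assumes X: "mspace X \<noteq> {}" and S: "simplex_space lam S" and lam: "lam > 0"
    and card: "|mspace S| \<le>o |mspace X|"
  shows "2 * ghdist S X = (INF D\<in>partitions |mspace S| X. partition_cost lam X D)"
proof (rule antisym)
  show "2 * ghdist S X \<le> (INF D\<in>partitions |mspace S| X. partition_cost lam X D)"
  proof (rule INF_greatest)
    fix D assume "D \<in> partitions |mspace S| X"
    then obtain g where g: "g ` mspace X = mspace S" "D = fibres g (mspace X)"
      by (rule partition_eq_fibres)
    show "2 * ghdist S X \<le> partition_cost lam X D"
    proof (rule ereal_le_real)
      fix t assume t: "partition_cost lam X D \<le> ereal t"
      then have dis: "\<forall>x\<in>mspace X. \<forall>y\<in>mspace X. \<bar>mdist X x y - mdist S (g x) (g y)\<bar> \<le> t"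
        using distortion_le_iff_partition_cost_le[OF S lam g(1)] g(2) by simp
      then have t0: "0 \<le> t" using X by fastforce
      show "2 * ghdist S X \<le> ereal t"
      proof (rule ereal_le_epsilon2)
        fix e :: real assume "e > 0"
        then have "ghdist S X \<le> ereal ((t + e) / 2)"
          using dis t0 by (intro ghdist_le_half_distortion[OF X g(1)]) force+
        then show "2 * ghdist S X \<le> ereal t + ereal e"
          by (cases "ghdist S X") auto
      qed
    qed
  qed
next
  show "(INF D\<in>partitions |mspace S| X. partition_cost lam X D) \<le> 2 * ghdist S X"
  proof (rule ereal_le_real)
    fix t assume t: "2 * ghdist S X \<le> ereal t"
    show "(INF D\<in>partitions |mspace S| X. partition_cost lam X D) \<le> ereal t"
    proof (rule ereal_le_epsilon2)
      fix e :: real assume e: "e > 0"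
      have less: "ghdist S X < ereal ((t + e) / 2)"
        using t e by (cases "ghdist S X") auto
      obtain R where R: "\<And>i. i \<in> mspace S \<Longrightarrow> \<exists>x\<in>mspace X. R i x"
        "\<And>x. x \<in> mspace X \<Longrightarrow> \<exists>i\<in>mspace S. R i x"
        "\<And>x x' i i'. \<lbrakk>x \<in> mspace X; x' \<in> mspace X; i \<in> mspace S; i' \<in> mspace S; R i x; R i' x'\<rbrakk>
           \<Longrightarrow> \<bar>mdist X x x' - mdist S i i'\<bar> \<le> 2 * ((t + e) / 2)"
        by (rule ghdist_lessD_correspondence[OF less]) (rule that)
      have "\<exists>g. g ` mspace X = mspace S \<and> (\<forall>x\<in>mspace X. \<forall>x'\<in>mspace X.
          \<bar>mdist X x x' - mdist S (g x) (g x')\<bar> \<le> 2 * ((t + e) / 2))"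
        by (rule simplex_correspondence_surjection[OF S card, where R = R]) (fact R)+
      then obtain g where g: "g ` mspace X = mspace S" and
        "\<forall>x\<in>mspace X. \<forall>x'\<in>mspace X. \<bar>mdist X x x' - mdist S (g x) (g x')\<bar> \<le> 2 * ((t + e) / 2)"
        by blast
      then have "partition_cost lam X (fibres g (mspace X)) \<le> ereal (2 * ((t + e) / 2))"
        by (simp only: distortion_le_iff_partition_cost_le[OF S lam g])
      then have "partition_cost lam X (fibres g (mspace X)) \<le> ereal (t + e)" by (simp add: add_divide_distrib)
      with fibres_in_partitions[OF g]
      show "(INF D\<in>partitions |mspace S| X. partition_cost lam X D) \<le> ereal t + ereal e"
        unfolding plus_ereal.simps by (rule INF_lower2)
    qed
  qed
qed

section \<open>Bounds for the infimum over partitions\<close>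

lemma INF_partition_cost_ge:
  "max (dpart m X) (max (ereal lam - alpha m X) (ediam X (mspace X) - ereal lam))
     \<le> (INF D\<in>partitions m X. partition_cost lam X D)"
  unfolding partition_cost_def dpart_def alpha_def
  by (intro INF_greatest max.mono ereal_minus_mono INF_lower SUP_upper order_refl)

text \<open>
  A partition of nearly least diameter is used, and \<open>part_alpha\<close> is estimated by its least value
  over all partitions.
\<close>

lemma INF_partition_cost_le_dpart:
  "(INF D\<in>partitions m X. partition_cost lam X D) \<le>
     max (dpart m X) (max (ereal lam - alpha_minus m X) (ediam X (mspace X) - ereal lam))"
  (is "_ \<le> max ?d (max ?a ?b)")
proof (rule dense_ge)
  fix y assume y: "max ?d (max ?a ?b) < y"
  then obtain D where D: "D \<in> partitions m X" "part_diam X D < y"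
    by (auto simp: dpart_def INF_less_iff)
  have "ereal lam - part_alpha X D \<le> ?a"
    unfolding alpha_minus_def by (intro ereal_minus_mono INF_lower D order_refl)
  then have "partition_cost lam X D \<le> y" using y D by (auto simp: partition_cost_def)
  then show "(INF D\<in>partitions m X. partition_cost lam X D) \<le> y" using D by (intro INF_lower2)
qed

text \<open>
  Here \<open>part_alpha\<close> is nearly greatest, and \<open>part_diam\<close> is estimated by its greatest value.
\<close>

lemma INF_partition_cost_le_dpart_plus:
  "(INF D\<in>partitions m X. partition_cost lam X D) \<le>
     max (dpart_plus m X) (max (ereal lam - alpha m X) (ediam X (mspace X) - ereal lam))"
  (is "_ \<le> max ?d (max ?a ?b)")
proof (rule ereal_le_real)
  fix t assume t: "max ?d (max ?a ?b) \<le> ereal t"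
  show "(INF D\<in>partitions m X. partition_cost lam X D) \<le> ereal t"
  proof (rule ereal_le_epsilon2)
    fix e :: real assume e: "e > 0"
    have "ereal (lam - t - e) < alpha m X"
      using t e by (cases "alpha m X") auto
    then obtain D where D: "D \<in> partitions m X" "ereal (lam - t - e) < part_alpha X D"
      by (auto simp: alpha_def less_SUP_iff)
    have "ereal lam - part_alpha X D \<le> ereal (t + e)"
      using D(2) by (cases "part_alpha X D") auto
    moreover have "part_diam X D \<le> ereal t"
      using t D(1) by (auto simp: dpart_plus_def SUP_le_iff)
    moreover have "?b \<le> ereal t" using t by simp
    moreover have "ereal t \<le> ereal (t + e)" using e by simp
    ultimately have "partition_cost lam X D \<le> ereal (t + e)"
      unfolding partition_cost_def by (meson max.boundedI order_trans)
    with D(1) show "(INF D\<in>partitions m X. partition_cost lam X D) \<le> ereal t + ereal e"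
      by (simp add: INF_lower2)
  qed
qed

section \<open>The three ranges of the edge length\<close>

lemma part_diam_bounds:
  assumes "mspace X \<noteq> {}" "D \<in> partitions m X"
  shows "0 \<le> part_diam X D" and "part_diam X D \<le> ediam X (mspace X)"
proof -
  have P: "partition_on (mspace X) D" using assms by (simp add: partitions_def)
  then have sub: "A \<subseteq> mspace X" if "A \<in> D" for A using that by (auto simp: partition_on_def)
  obtain x A where x: "x \<in> A" "A \<in> D" using assms(1) P unfolding partition_on_def by blast
  have "0 \<le> ereal (mdist X x x)" by simp
  also have "\<dots> \<le> ediam X A" unfolding ediam_def using x by (meson SUP_upper2 order_refl)
  also have "\<dots> \<le> part_diam X D" unfolding part_diam_def using x by (simp add: SUP_upper)
  finally show "0 \<le> part_diam X D" .
  show "part_diam X D \<le> ediam X (mspace X)"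
    unfolding part_diam_def ediam_def using sub by (intro SUP_least SUP_subset_mono) auto
qed

lemma part_alpha_nonneg: "0 \<le> part_alpha X D"
  unfolding part_alpha_def egap_def by (auto intro!: Inf_greatest INF_greatest)

lemma ediam_less_infinity_if_mbounded:
  assumes "Metric_space.mbounded (mspace X) (mdist X) (mspace X)"
  shows "ediam X (mspace X) < \<infinity>"
proof -
  obtain B where B: "\<forall>x\<in>mspace X. \<forall>y\<in>mspace X. mdist X x y \<le> B"
    using assms unfolding Metric_space.mbounded_alt[OF Metric_space_mspace_mdist] by (elim conjE exE)
  then have "ediam X (mspace X) \<le> ereal B" by (simp add: ediam_def SUP_le_iff)
  then show ?thesis by (cases "ediam X (mspace X)") auto
qed

theorem corollary2p18:
  fixes X :: "'a metric" and S :: "'b metric" and lam :: real and m :: "'b rel"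
  assumes "mspace X \<noteq> {}"
    and "Metric_space.mbounded (mspace X) (mdist X) (mspace X)"
    and "lam > 0"
    and "simplex_space lam S"
    and "m = |mspace S|"
    and "m \<le>o |mspace X|"
    and "2 * dpart m X \<le> ediam X (mspace X) - alpha_minus m X"
    and "ediam X (mspace X) - alpha_minus m X \<le> 2 * dpart_plus m X"
  shows "(ereal lam \<le> 1/2 * (alpha_minus m X + ediam X (mspace X)) \<longrightarrow>
            2 * ghdist S X = ediam X (mspace X) - ereal lam) \<and>
         (1/2 * (alpha_minus m X + ediam X (mspace X)) \<le> ereal lam \<and> ereal lam \<le> alpha m X + dpart_plus m X \<longrightarrow>
            Max {ediam X (mspace X) - ereal lam, ereal lam - alpha m X, dpart m X} \<le> 2 * ghdist S X \<and>
            2 * ghdist S X \<le> min (ereal lam - alpha_minus m X) (dpart_plus m X)) \<and>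
         (ereal lam \<ge> alpha m X + dpart_plus m X \<longrightarrow>
            2 * ghdist S X = ereal lam - alpha m X)"
proof -
  let ?G = "2 * ghdist S X" and ?P = "partitions m X"
  have G: "?G = (INF D\<in>?P. partition_cost lam X D)"
    using two_ghdist_simplex_eq[OF assms(1,4,3)] assms(5,6) by simp
  have lower: "max (dpart m X) (max (ereal lam - alpha m X) (ediam X (mspace X) - ereal lam)) \<le> ?G"
    unfolding G by (rule INF_partition_cost_ge)
  have upper: "?G \<le> max (dpart m X) (max (ereal lam - alpha_minus m X) (ediam X (mspace X) - ereal lam))"
    unfolding G by (rule INF_partition_cost_le_dpart)
  have upper_plus: "?G \<le> max (dpart_plus m X) (max (ereal lam - alpha m X) (ediam X (mspace X) - ereal lam))"
    unfolding G by (rule INF_partition_cost_le_dpart_plus)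
  have d0: "0 \<le> dpart m X"
    unfolding dpart_def using part_diam_bounds(1)[OF assms(1)] by (intro INF_greatest)
  have am0: "0 \<le> alpha_minus m X"
    unfolding alpha_minus_def by (intro INF_greatest part_alpha_nonneg)
  obtain x where "x \<in> mspace X" using assms(1) by blast
  then have "ereal (mdist X x x) \<le> ediam X (mspace X)"
    unfolding ediam_def by (meson SUP_upper2 order_refl)
  then obtain \<delta> where \<delta>: "ediam X (mspace X) = ereal \<delta>"
    using ediam_less_infinity_if_mbounded[OF assms(2)] by (cases "ediam X (mspace X)") auto
  \<comment> \<open>If \<open>alpha_minus\<close> were infinite, the difference in the hypothesis would be \<open>-\<infinity>\<close>, below \<open>2 * dpart\<close>.\<close>
  have "alpha_minus m X \<noteq> \<infinity>"
    using assms(7) d0 by (auto simp: \<delta>)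
  then obtain a where a: "alpha_minus m X = ereal a"
    using am0 by (cases "alpha_minus m X") auto
  \<comment> \<open>The infimum over an empty family would be infinite.\<close>
  then have "?P \<noteq> {}" by (auto simp: alpha_minus_def top_ereal_def)
  then obtain D where D: "D \<in> ?P" by blast
  have "dpart m X \<le> part_diam X D" "part_diam X D \<le> dpart_plus m X"
    using D by (auto simp: dpart_def dpart_plus_def intro: INF_lower SUP_upper)
  moreover have "dpart_plus m X \<le> ereal \<delta>"
    unfolding dpart_plus_def \<delta>[symmetric] by (intro SUP_least part_diam_bounds(2)[OF assms(1)])
  ultimately obtain d p where d: "dpart m X = ereal d" and p: "dpart_plus m X = ereal p"
    using d0 by (cases "dpart m X"; cases "dpart_plus m X") auto
  have "alpha_minus m X \<le> part_alpha X D" "part_alpha X D \<le> alpha m X"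
    using D by (auto simp: alpha_minus_def alpha_def intro: INF_lower SUP_upper)
  then have aa: "ereal a \<le> alpha m X" using a by simp
  have half: "1/2 * (ereal a + ereal \<delta>) = ereal ((a + \<delta>) / 2)"
    by (simp add: one_ereal_def numeral_eq_ereal ereal_divide)
  have h1: "2 * d \<le> \<delta> - a" and h2: "\<delta> - a \<le> 2 * p"
    using assms(7,8) by (simp_all add: a d p \<delta>)
  note vals = a d p \<delta> half
  obtain q where q: "?G = ereal q"
    using lower upper by (cases ?G) (auto simp: vals max_def split: if_splits)
  have lo: "d \<le> q" "\<delta> - lam \<le> q"
    using lower unfolding vals q by simp_all
  have up: "q \<le> d \<or> q \<le> lam - a \<or> q \<le> \<delta> - lam"
    using upper unfolding vals q by (simp add: le_max_iff_disj)
  show ?thesis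
  proof (cases "alpha m X")
    case (real b)
    have lo_b: "lam - b \<le> q" and ab: "a \<le> b"
      using lower aa unfolding vals q real by simp_all
    have up_b: "q \<le> p \<or> q \<le> lam - b \<or> q \<le> \<delta> - lam"
      using upper_plus unfolding vals q real by (simp add: le_max_iff_disj)
    have "q = \<delta> - lam" if "lam \<le> (a + \<delta>) / 2"
      using that lo up h1 by argo
    moreover have "q \<le> lam - a" "q \<le> p" if "(a + \<delta>) / 2 \<le> lam" "lam \<le> b + p"
      using that up up_b h1 h2 by argo+
    moreover have "q = lam - b" if "b + p \<le> lam"
      using that lo_b up_b ab h2 by argo
    ultimately show ?thesis
      using lo lo_b unfolding vals q real by simp
  next
    case PInf
    \<comment> \<open>The middle range of \<open>lam\<close> then has no upper end, and the last range is empty.\<close>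
    have up_inf: "q \<le> p \<or> q \<le> \<delta> - lam"
      using upper_plus unfolding vals q PInf by (simp add: le_max_iff_disj)
    have "q = \<delta> - lam" if "lam \<le> (a + \<delta>) / 2"
      using that lo up h1 by argo
    moreover have "q \<le> lam - a" "q \<le> p" if "(a + \<delta>) / 2 \<le> lam"
      using that up up_inf h1 h2 by argo+
    ultimately show ?thesis
      using lo unfolding vals q PInf by simp
  next
    case MInf
    then show ?thesis using aa by simp
  qed
qed

end
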